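(* Let $(V,H,L)$ be a holonomic space such that $V$ is an inner product space with the norm $\|\cdot\|$ induced by the inner product. Let $\rho_0=\mathrm{HolRad}(0)\in(0,\infty]$ be the holonomy radius at the origin of $V$. Then the identity map on $H$ is Lipschitz from $H$ with the left-invariant metric $(a,b)\mapsto L(a^{-1}b)$ to $H$ with the left-invariant metric $(a,b)\mapsto\sqrt{2\|a-b\|}$, where $\|a-b\|$ is the operator norm; namely $$\sqrt{2\|a-b\|}\le\frac{1}{\rho_0}L(a^{-1}b)\quad\text{for all }a,b\in H.$$ Moreover, the dilation of this map (its smallest Lipschitz constant) is precisely $1/\rho_0$, with the convention $1/\infty=0$.
   Context: A group-norm on a group $G$ is a function $N:G\to\mathbb{R}$ such that $N(A)\ge 0$; $N(A)=0$ if and only if $A$ is the identity; $N(A^{-1})=N(A)$; and $N(AB)\le N(A)+N(B)$, for all $A,B\in G$. A triplet $(V,H,L)$, with $V$ a normed vector space, $H$ a subgroup of the group of norm-preserving linear automorphisms of $V$, and $L:H\to\mathbb{R}$ a group-norm on $H$, is a holonomic space if: (P) for all $u\in V$ there exists $r>0$ such that for all $v,w\in V$ with $\|v-u\|<r$, $\|w-u\|<r$, and all $A\in H$, $$\|v-w\|^2-\|v-Aw\|^2\le L^2(A).$$ The holonomy radius $\mathrm{HolRad}(u)\in(0,\infty]$ of $u\in V$ is the supremum of the radii $r>0$ for which the condition in (P) holds at $u$. *)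

theory Defs
  imports "HOL-Analysis.Analysis" "HOL-Algebra.Group"
begin

locale group_norm = group G for G :: "('a, 'b) monoid_scheme" (structure) +
  fixes N :: "'a \<Rightarrow> real"
  assumes nonneg: "x \<in> carrier G \<Longrightarrow> 0 \<le> N x"
    and eq_zero_iff: "x \<in> carrier G \<Longrightarrow> N x = 0 \<longleftrightarrow> x = \<one>"
    and inverse: "x \<in> carrier G \<Longrightarrow> N (inv x) = N x"
    and subadditive: "\<lbrakk>x \<in> carrier G; y \<in> carrier G\<rbrakk> \<Longrightarrow> N (x \<otimes> y) \<le> N x + N y"

definition norm_aut :: "('v::real_normed_vector \<Rightarrow> 'v) monoid" where
  "norm_aut = \<lparr>carrier = {f. linear f \<and> bij f \<and> (\<forall>x. norm (f x) = norm x)},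
               mult = (\<circ>), one = id\<rparr>"

definition hol_condition ::
  "('v::real_normed_vector \<Rightarrow> 'v) set \<Rightarrow> (('v \<Rightarrow> 'v) \<Rightarrow> real) \<Rightarrow> 'v \<Rightarrow> real \<Rightarrow> bool" where
  "hol_condition H L u r \<longleftrightarrow>
     (\<forall>v w. \<forall>A\<in>H. norm (v - u) < r \<and> norm (w - u) < r \<longrightarrow>
        (norm (v - w))\<^sup>2 - (norm (v - A w))\<^sup>2 \<le> (L A)\<^sup>2)"

text \<open>The vector space is the whole type; only the values of \<open>L\<close> on \<open>H\<close> matter.\<close>

locale holonomic_space =
  fixes H :: "('v::real_normed_vector \<Rightarrow> 'v) set" and L :: "('v \<Rightarrow> 'v) \<Rightarrow> real"
  assumes subgroup: "subgroup H norm_aut"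
    and group_norm: "group_norm (norm_aut\<lparr>carrier := H\<rparr>) L"
    and local_condition: "\<exists>r>0. hol_condition H L u r"

definition hol_rad ::
  "('v::real_normed_vector \<Rightarrow> 'v) set \<Rightarrow> (('v \<Rightarrow> 'v) \<Rightarrow> real) \<Rightarrow> 'v \<Rightarrow> ereal" where
  "hol_rad H L u = Sup {ereal r |r. 0 < r \<and> hol_condition H L u r}"

text \<open>
  \<open>Metric_space M d\<close> demands symmetry and nonnegativity of \<open>d\<close> on the whole type, not just
  on \<open>M\<close>; so a distance that is meaningful only on \<open>M\<close> is set to zero elsewhere.
\<close>

definition dist_on :: "'a set \<Rightarrow> ('a \<Rightarrow> 'a \<Rightarrow> real) \<Rightarrow> 'a \<Rightarrow> 'a \<Rightarrow> real" where
  "dist_on M d x y = (if x \<in> M \<and> y \<in> M then d x y else 0)"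

definition left_invariant_metric ::
  "('a, 'b) monoid_scheme \<Rightarrow> ('a \<Rightarrow> 'a \<Rightarrow> real) \<Rightarrow> bool" where
  "left_invariant_metric G d \<longleftrightarrow>
     Metric_space (carrier G) (dist_on (carrier G) d) \<and>
     (\<forall>a\<in>carrier G. \<forall>b\<in>carrier G. \<forall>c\<in>carrier G. d (c \<otimes>\<^bsub>G\<^esub> a) (c \<otimes>\<^bsub>G\<^esub> b) = d a b)"

definition group_norm_dist :: "(('v::real_normed_vector \<Rightarrow> 'v) \<Rightarrow> real) \<Rightarrow> ('v \<Rightarrow> 'v) \<Rightarrow> ('v \<Rightarrow> 'v) \<Rightarrow> real" where
  "group_norm_dist L a b = L (inv\<^bsub>norm_aut\<^esub> a \<otimes>\<^bsub>norm_aut\<^esub> b)"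

definition op_dist :: "('v::real_normed_vector \<Rightarrow> 'v) \<Rightarrow> ('v \<Rightarrow> 'v) \<Rightarrow> real" where
  "op_dist a b = sqrt (2 * onorm (\<lambda>x. a x - b x))"

text \<open>
  Lipschitz constants must be nonnegative; otherwise there would be no smallest one for a map
  out of a one-point space.
\<close>

definition lipschitz_constant :: "'a metric \<Rightarrow> 'b metric \<Rightarrow> ('a \<Rightarrow> 'b) \<Rightarrow> real \<Rightarrow> bool" where
  "lipschitz_constant m1 m2 f C \<longleftrightarrow>
     0 \<le> C \<and> (\<forall>x\<in>mspace m1. \<forall>y\<in>mspace m1. mdist m2 (f x) (f y) \<le> C * mdist m1 x y)"

definition is_dilation :: "'a metric \<Rightarrow> 'b metric \<Rightarrow> ('a \<Rightarrow> 'b) \<Rightarrow> real \<Rightarrow> bool" where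
  "is_dilation m1 m2 f K \<longleftrightarrow>
     lipschitz_constant m1 m2 f K \<and> (\<forall>C. lipschitz_constant m1 m2 f C \<longrightarrow> K \<le> C)"

end

theory Submission
  imports Defs
begin

text \<open>
  For a norm-preserving linear \<open>A\<close>, \<open>\<parallel>v - w\<parallel>\<^sup>2 - \<parallel>v - A w\<parallel>\<^sup>2 = 2 \<langle>v, A w - w\<rangle>\<close>, and
  the supremum of the right-hand side over \<open>\<parallel>v\<parallel>, \<parallel>w\<parallel> < r\<close> is \<open>2 r\<^sup>2 \<parallel>A - I\<parallel>\<close>. Hence the holonomy
  condition at the origin holds for \<open>r\<close> if and only if \<open>r \<surd>(2 \<parallel>A - I\<parallel>) \<le> L A\<close> on \<open>H\<close>, that is, if
  and only if \<open>1 / r\<close> is a Lipschitz constant at the identity, which by left invariance is the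
  same as being a Lipschitz constant.
\<close>

section \<open>The group of norm-preserving linear automorphisms\<close>

lemma in_norm_aut_iff:
  "f \<in> carrier norm_aut \<longleftrightarrow> linear f \<and> bij f \<and> (\<forall>x. norm (f x) = norm x)"
  by (simp add: norm_aut_def)

lemma mult_norm_aut [simp]: "f \<otimes>\<^bsub>norm_aut\<^esub> g = f \<circ> g"
  by (simp add: norm_aut_def)

lemma one_norm_aut [simp]: "\<one>\<^bsub>norm_aut\<^esub> = id"
  by (simp add: norm_aut_def)

lemma inv_in_norm_aut:
  assumes "f \<in> carrier norm_aut"
  shows "inv_into UNIV f \<in> carrier norm_aut"
proof -
  have f: "linear f" "bij f" "\<And>x. norm (f x) = norm x"
    using assms by (auto simp: in_norm_aut_iff)
  have fi: "f (inv_into UNIV f x) = x" for x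
    using f(2) by (simp add: bij_is_surj surj_f_inv_f)
  have eqI: "x = y" if "f x = f y" for x y
    using f(2) that by (meson bij_is_inj injD)
  have "linear (inv_into UNIV f)"
    \<comment> \<open>Both linearity equations are checked after applying the injective map
      \<open>f\<close>.\<close>
    by (rule linearI; rule eqI) (simp_all add: fi linear_add[OF f(1)] linear_cmul[OF f(1)])
  moreover have "norm (inv_into UNIV f x) = norm x" for x
    by (metis f(3) fi)
  ultimately show ?thesis
    using f(2) by (simp add: in_norm_aut_iff bij_imp_bij_inv)
qed

lemma group_norm_aut: "group norm_aut"
proof (rule groupI)
  fix f :: "'a \<Rightarrow> 'a"
  assume f: "f \<in> carrier norm_aut"
  then have "inv_into UNIV f \<circ> f = id"
    by (simp add: in_norm_aut_iff bij_is_inj)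
  then show "\<exists>g\<in>carrier norm_aut. g \<otimes>\<^bsub>norm_aut\<^esub> f = \<one>\<^bsub>norm_aut\<^esub>"
    using inv_in_norm_aut[OF f] by auto
qed (auto simp: in_norm_aut_iff linear_compose bij_comp linear_id comp_assoc)

lemma norm_aut_inv_cancel:
  assumes "a \<in> carrier norm_aut"
  shows "a ((inv\<^bsub>norm_aut\<^esub> a) x) = x"
  using group.r_inv[OF group_norm_aut assms] by (metis comp_apply id_apply mult_norm_aut one_norm_aut)

lemma norm_aut_bounded_linear:
  assumes "f \<in> carrier norm_aut"
  shows "bounded_linear f"
  using assms by (intro bounded_linear_intro[where K = 1])
    (auto simp: in_norm_aut_iff linear_add linear_cmul)

lemma norm_aut_bounded_linear_diff:
  assumes "a \<in> carrier norm_aut" "b \<in> carrier norm_aut"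
  shows "bounded_linear (\<lambda>x. a x - b x)"
  using assms by (intro bounded_linear_sub norm_aut_bounded_linear)

section \<open>The operator-norm distance and its left invariance\<close>

lemma op_dist_nonneg:
  assumes "a \<in> carrier norm_aut" "b \<in> carrier norm_aut"
  shows "0 \<le> op_dist a b"
  unfolding op_dist_def using onorm_pos_le[OF norm_aut_bounded_linear_diff[OF assms]] by simp

text \<open>A linear isometry \<open>c\<close> leaves the norm of \<open>a x - b x\<close> unchanged
  at every \<open>x\<close>, so both operator norms are the same supremum.\<close>

lemma op_dist_left_mult:
  assumes "c \<in> carrier norm_aut"
  shows "op_dist (c \<circ> a) (c \<circ> b) = op_dist a b"
proof -
  have "linear c" "\<And>x. norm (c x) = norm x"
    using assms by (auto simp: in_norm_aut_iff)
  then have "norm (c (a x) - c (b x)) = norm (a x - b x)" for x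
    by (metis linear_diff)
  then show ?thesis
    by (simp add: op_dist_def onorm_def)
qed

text \<open>Cancelling \<open>a\<close> on the left moves a pair to one containing the identity,
  where the holonomy condition can be compared with \<open>op_dist\<close>.\<close>

lemma op_dist_inv_mult:
  assumes "a \<in> carrier norm_aut"
  shows "op_dist a b = op_dist (inv\<^bsub>norm_aut\<^esub> a \<circ> b) id"
proof -
  have "op_dist a b = op_dist (a \<circ> id) (a \<circ> (inv\<^bsub>norm_aut\<^esub> a \<circ> b))"
    by (simp add: comp_def norm_aut_inv_cancel[OF assms])
  also have "\<dots> = op_dist id (inv\<^bsub>norm_aut\<^esub> a \<circ> b)"
    by (rule op_dist_left_mult[OF assms])
  also have "\<dots> = op_dist (inv\<^bsub>norm_aut\<^esub> a \<circ> b) id"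
    by (simp add: op_dist_def onorm_def norm_minus_commute)
  finally show ?thesis .
qed

lemma op_dist_eq_zero_iff:
  assumes "a \<in> carrier norm_aut" "b \<in> carrier norm_aut"
  shows "op_dist a b = 0 \<longleftrightarrow> a = b"
  using onorm_eq_0[OF norm_aut_bounded_linear_diff[OF assms]]
  by (auto simp: op_dist_def fun_eq_iff)

text \<open>The operator norm satisfies the triangle inequality, and the square root is monotone and
  subadditive.\<close>

lemma op_dist_triangle:
  assumes "a \<in> carrier norm_aut" "b \<in> carrier norm_aut" "c \<in> carrier norm_aut"
  shows "op_dist a c \<le> op_dist a b + op_dist b c"
proof -
  let ?d = "\<lambda>a b. onorm (\<lambda>x. a x - b x)"
  have pos: "0 \<le> ?d a b" "0 \<le> ?d b c"
    using assms by (auto intro: onorm_pos_le norm_aut_bounded_linear_diff)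
  have "?d a c = onorm (\<lambda>x. (a x - b x) + (b x - c x))"
    by simp
  also have "\<dots> \<le> ?d a b + ?d b c"
    using assms by (intro onorm_triangle norm_aut_bounded_linear_diff)
  finally have "op_dist a c \<le> sqrt (2 * ?d a b + 2 * ?d b c)"
    by (simp add: op_dist_def)
  also have "\<dots> \<le> op_dist a b + op_dist b c"
    unfolding op_dist_def using pos by (intro sqrt_add_le_add_sqrt) auto
  finally show ?thesis .
qed

lemma left_invariant_metric_op_dist:
  assumes "H \<subseteq> carrier norm_aut"
  shows "left_invariant_metric (norm_aut\<lparr>carrier := H\<rparr>) op_dist"
proof -
  have "Metric_space H (dist_on H op_dist)"
  proof
    show "0 \<le> dist_on H op_dist x y" for x y
      using assms by (auto simp: dist_on_def intro!: op_dist_nonneg)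
    show "dist_on H op_dist x y = dist_on H op_dist y x" for x y
      by (simp add: dist_on_def op_dist_def onorm_def norm_minus_commute)
    show "dist_on H op_dist x y = 0 \<longleftrightarrow> x = y" if "x \<in> H" "y \<in> H" for x y
      using that assms op_dist_eq_zero_iff[of x y] by (auto simp: dist_on_def)
    show "dist_on H op_dist x z \<le> dist_on H op_dist x y + dist_on H op_dist y z"
      if "x \<in> H" "y \<in> H" "z \<in> H" for x y z
      using that assms op_dist_triangle[of x y z] by (auto simp: dist_on_def)
  qed
  then show ?thesis
    using assms op_dist_left_mult by (auto simp: left_invariant_metric_def)
qed

section \<open>The left-invariant metric of a group-norm\<close>

text \<open>Symmetry comes from inverting \<open>inv x \<otimes> y\<close>, the triangle inequality
  from a telescoping product. The distance \<open>d\<close> is prescribed only on the carrier, so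
  that \<open>group_norm_dist\<close>, whose inverse is taken in \<open>norm_aut\<close>, fits the
  subgroup \<open>H\<close>.\<close>

lemma (in group_norm) left_invariant_metric_norm:
  assumes d: "\<And>x y. \<lbrakk>x \<in> carrier G; y \<in> carrier G\<rbrakk> \<Longrightarrow> d x y = N (inv x \<otimes> y)"
  shows "left_invariant_metric G d"
proof -
  have inv_cancel: "inv y \<otimes> (y \<otimes> z) = z" "y \<otimes> (inv y \<otimes> z) = z"
    if "y \<in> carrier G" "z \<in> carrier G" for y z
    using that by (simp_all flip: m_assoc)
  have "Metric_space (carrier G) (dist_on (carrier G) d)"
  proof
    show "0 \<le> dist_on (carrier G) d x y" for x y
      by (simp add: dist_on_def d nonneg)
    show "dist_on (carrier G) d x y = dist_on (carrier G) d y x" for x y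
    proof (cases "x \<in> carrier G \<and> y \<in> carrier G")
      case True
      then have "N (inv (inv x \<otimes> y)) = N (inv x \<otimes> y)"
        by (intro inverse) simp
      then show ?thesis
        using True by (simp add: dist_on_def d inv_mult_group)
    qed (auto simp: dist_on_def)
    show "dist_on (carrier G) d x y = 0 \<longleftrightarrow> x = y"
      if "x \<in> carrier G" "y \<in> carrier G" for x y
    proof -
      have "inv x \<otimes> y = \<one> \<longleftrightarrow> x = y"
        using that inv_inv inv_equality[of "inv x" y] by (metis inv_closed l_inv)
      then show ?thesis
        using that by (simp add: dist_on_def d eq_zero_iff)
    qed
    show "dist_on (carrier G) d x z \<le> dist_on (carrier G) d x y + dist_on (carrier G) d y z"
      if "x \<in> carrier G" "y \<in> carrier G" "z \<in> carrier G" for x y z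
    proof -
      have "(inv x \<otimes> y) \<otimes> (inv y \<otimes> z) = inv x \<otimes> z"
        using that by (simp add: m_assoc inv_cancel)
      then show ?thesis
        using that subadditive[of "inv x \<otimes> y" "inv y \<otimes> z"] by (simp add: dist_on_def d)
    qed
  qed
  moreover have "d (c \<otimes> a) (c \<otimes> b) = d a b"
    if "a \<in> carrier G" "b \<in> carrier G" "c \<in> carrier G" for a b c
  proof -
    have "inv (c \<otimes> a) \<otimes> (c \<otimes> b) = inv a \<otimes> b"
      using that by (simp add: inv_mult_group m_assoc inv_cancel)
    then show ?thesis
      using that by (simp add: d)
  qed
  ultimately show ?thesis
    by (simp add: left_invariant_metric_def)
qed

section \<open>The holonomy condition at the origin\<close>

text \<open>This is the limit of \<open>t\<close> tending to \<open>r\<close> from below; it is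
  needed because the balls in the holonomy condition are open.\<close>

lemma mult_le_of_less:
  fixes r s c :: real
  assumes "0 < r" and le: "\<And>t. \<lbrakk>0 < t; t < r\<rbrakk> \<Longrightarrow> t * s \<le> c"
  shows "r * s \<le> c"
proof (rule field_le_mult_one_interval)
  fix z :: real
  assume "0 < z" "z < 1"
  then show "z * (r * s) \<le> c"
    using le[of "z * r"] \<open>0 < r\<close> by (simp add: mult.assoc)
qed

text \<open>Expanding both squares, the terms \<open>inner w w\<close> and
  \<open>inner (A w) (A w)\<close> cancel. The identity rests on the inner product.\<close>

lemma norm_aut_defect:
  fixes A :: "'v::real_inner \<Rightarrow> 'v"
  assumes "A \<in> carrier norm_aut"
  shows "(norm (v - w))\<^sup>2 - (norm (v - A w))\<^sup>2 = 2 * inner v (A w - w)"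
proof -
  have "inner (A w) (A w) = inner w w"
    using assms by (simp add: in_norm_aut_iff norm_eq)
  then show ?thesis
    by (simp add: power2_norm_eq_inner algebra_simps inner_commute)
qed

text \<open>From right to left this is Cauchy-Schwarz; from left to right, vectors attaining
  equality in it are inserted. Since the condition sees only the square of \<open>L A\<close>,
  nonnegativity of \<open>L\<close> permits taking roots.\<close>

lemma hol_condition_zero_iff:
  fixes H :: "('v::real_inner \<Rightarrow> 'v) set"
  assumes H: "H \<subseteq> carrier norm_aut" and L: "\<And>A. A \<in> H \<Longrightarrow> 0 \<le> L A" and r: "0 < r"
  shows "hol_condition H L 0 r \<longleftrightarrow> (\<forall>A\<in>H. r * op_dist A id \<le> L A)"
proof (intro iffI ballI)
  fix A
  assume hol: "hol_condition H L 0 r" and A: "A \<in> H"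
  have AN: "A \<in> carrier norm_aut"
    using A H by blast
  show "r * op_dist A id \<le> L A"
  proof (rule mult_le_of_less[OF r])
    fix t :: real
    assume t: "0 < t" "t < r"
    have "norm (A w - w) \<le> (L A)\<^sup>2 / (2 * t\<^sup>2) * norm w" for w
    proof (cases "w = 0 \<or> A w - w = 0")
      case True
      then show ?thesis
        using AN by (auto simp: in_norm_aut_iff linear_0)
    next
      case False
      \<comment> \<open>Both vectors have norm \<open>t < r\<close>. As \<open>v'\<close> is
        parallel to \<open>A w - w\<close>, and hence to \<open>A w' - w'\<close>, Cauchy-Schwarz is
        an equality for this pair.\<close>
      define v' where "v' = (t / norm (A w - w)) *\<^sub>R (A w - w)"
      define w' where "w' = (t / norm w) *\<^sub>R w"
      have A_w': "A w' - w' = (t / norm w) *\<^sub>R (A w - w)"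
        using AN by (simp add: w'_def in_norm_aut_iff linear_cmul scaleR_diff_right)
      have "norm v' < r" "norm w' < r"
        using False t by (auto simp: v'_def w'_def)
      then have "(norm (v' - w'))\<^sup>2 - (norm (v' - A w'))\<^sup>2 \<le> (L A)\<^sup>2"
        using hol A by (simp add: hol_condition_def)
      moreover have "inner v' (A w' - w') = t\<^sup>2 * norm (A w - w) / norm w"
        unfolding A_w' v'_def using False
        by (simp add: power2_norm_eq_inner[symmetric] power2_eq_square)
      ultimately have "2 * (t\<^sup>2 * norm (A w - w) / norm w) \<le> (L A)\<^sup>2"
        by (simp add: norm_aut_defect[OF AN])
      then show ?thesis
        using False t by (simp add: field_simps)
    qed
    then have "onorm (\<lambda>w. A w - id w) \<le> (L A)\<^sup>2 / (2 * t\<^sup>2)"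
      by (intro onorm_bound) auto
    then have "t\<^sup>2 * (2 * onorm (\<lambda>w. A w - id w)) \<le> (L A)\<^sup>2"
      using t by (simp add: field_simps)
    then have "sqrt (t\<^sup>2 * (2 * onorm (\<lambda>w. A w - id w))) \<le> L A"
      using L[OF A] by (simp add: real_le_lsqrt)
    then show "t * op_dist A id \<le> L A"
      using t by (simp add: op_dist_def real_sqrt_mult)
  qed
next
  assume le: "\<forall>A\<in>H. r * op_dist A id \<le> L A"
  show "hol_condition H L 0 r"
    unfolding hol_condition_def
  proof (intro allI ballI impI)
    fix v w :: 'v and A
    assume A: "A \<in> H" and vw: "norm (v - 0) < r \<and> norm (w - 0) < r"
    have AN: "A \<in> carrier norm_aut"
      using A H by blast
    have id: "id \<in> carrier norm_aut"
      by (simp add: in_norm_aut_iff linear_id)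
    have bl: "bounded_linear (\<lambda>x. A x - id x)"
      using AN id by (rule norm_aut_bounded_linear_diff)
    let ?n = "onorm (\<lambda>x. A x - id x)"
    have n: "0 \<le> ?n"
      using bl by (rule onorm_pos_le)
    have "norm (A w - w) \<le> ?n * norm w"
      using onorm[OF bl, of w] by simp
    also have "\<dots> \<le> ?n * r"
      using vw n by (intro mult_left_mono) auto
    finally have "norm v * norm (A w - w) \<le> r * (?n * r)"
      using vw r by (intro mult_mono) auto
    then have "inner v (A w - w) \<le> r * (?n * r)"
      using norm_cauchy_schwarz[of v "A w - w"] by linarith
    then have "(norm (v - w))\<^sup>2 - (norm (v - A w))\<^sup>2 \<le> (r * op_dist A id)\<^sup>2"
      unfolding norm_aut_defect[OF AN] using n
      by (simp add: op_dist_def power_mult_distrib) (simp add: power2_eq_square mult_ac)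
    also have "\<dots> \<le> (L A)\<^sup>2"
      using le A r op_dist_nonneg[OF AN id] by (intro power_mono) auto
    finally show "(norm (v - w))\<^sup>2 - (norm (v - A w))\<^sup>2 \<le> (L A)\<^sup>2" .
  qed
qed

section \<open>From admissible radii to the holonomy radius\<close>

text \<open>Any positive \<open>t\<close> below the supremum lies below an admissible radius, so
  \<open>t * s \<le> c\<close> because \<open>s\<close> is nonnegative; then \<open>t\<close> tends
  to the supremum. It will be used with \<open>s\<close> a value of \<open>op_dist\<close> and
  \<open>c\<close> a value of \<open>L\<close>.\<close>

lemma hol_rad_bound:
  assumes "0 < hol_rad H L 0" "0 \<le> s"
    and le: "\<And>r. \<lbrakk>0 < r; hol_condition H L 0 r\<rbrakk> \<Longrightarrow> r * s \<le> c"
  shows "s \<le> real_of_ereal (1 / hol_rad H L 0) * c"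
proof -
  have le': "t * s \<le> c" if t: "0 < t" "ereal t < hol_rad H L 0" for t
  proof -
    obtain r where "t < r" "0 < r" "hol_condition H L 0 r"
      using t by (auto simp: hol_rad_def less_Sup_iff)
    then show ?thesis
      using le[of r] mult_right_mono[of t r s] \<open>0 \<le> s\<close> by linarith
  qed
  show ?thesis
  proof (cases "hol_rad H L 0")
    case (real \<rho>)
    then have "0 < \<rho>"
      using assms by auto
    then have "\<rho> * s \<le> c"
    proof (rule mult_le_of_less)
      show "t * s \<le> c" if "0 < t" "t < \<rho>" for t
        using that real by (intro le') simp_all
    qed
    then show ?thesis
      using real \<open>0 < \<rho>\<close> by (simp add: field_simps one_ereal_def)
  next
    case PInf
    \<comment> \<open>With an infinite radius every positive \<open>t\<close> satisfies
      \<open>t * s \<le> c\<close>; for \<open>s > 0\<close> the choice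
      \<open>t = (\<bar>c\<bar> + 1) / s\<close> would contradict this. The factor is then 0, so the
      goal is exactly this bound.\<close>
    have "s \<le> 0"
    proof (rule ccontr)
      assume "\<not> s \<le> 0"
      then have "0 < (\<bar>c\<bar> + 1) / s" "(\<bar>c\<bar> + 1) / s * s = \<bar>c\<bar> + 1"
        by auto
      then show False
        using le'[of "(\<bar>c\<bar> + 1) / s"] PInf by auto
    qed
    then show ?thesis
      using PInf by simp
  qed (use assms in auto)
qed

text \<open>The radius \<open>1 / C\<close> belongs to the set whose supremum is taken, and
  reciprocals reverse the order; an infinite supremum gives the value 0.\<close>

lemma inverse_hol_rad_le:
  assumes "0 < C" "hol_condition H L 0 (1 / C)"
  shows "real_of_ereal (1 / hol_rad H L 0) \<le> C"
proof -
  have ge: "ereal (1 / C) \<le> hol_rad H L 0"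
    unfolding hol_rad_def using assms by (intro Sup_upper) auto
  show ?thesis
  proof (cases "hol_rad H L 0")
    case (real \<rho>)
    then have "1 / C \<le> \<rho>"
      using ge by simp
    moreover have "0 < 1 / C"
      using assms by simp
    ultimately have "0 < \<rho>"
      by linarith
    then show ?thesis
      using real \<open>1 / C \<le> \<rho>\<close> assms by (simp add: field_simps one_ereal_def)
  qed (use ge assms in auto)
qed

text \<open>Positivity of the radius makes \<open>1 / hol_rad H L 0\<close> finite, with value 0 at
  infinity, so \<open>real_of_ereal\<close> does not fall back on its default value.\<close>

theorem theoremB:
  fixes H :: "('v::real_inner \<Rightarrow> 'v) set" and L :: "('v \<Rightarrow> 'v) \<Rightarrow> real"
  assumes "holonomic_space H L"
  shows "0 < hol_rad H L 0 \<and>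
    left_invariant_metric (norm_aut\<lparr>carrier := H\<rparr>) (group_norm_dist L) \<and>
    left_invariant_metric (norm_aut\<lparr>carrier := H\<rparr>) op_dist \<and>
    Lipschitz_continuous_map (metric (H, dist_on H (group_norm_dist L)))
           (metric (H, dist_on H op_dist)) (\<lambda>a. a) \<and>
    (\<forall>a\<in>H. \<forall>b\<in>H. sqrt (2 * onorm (\<lambda>x. a x - b x))
           \<le> real_of_ereal (1 / hol_rad H L 0) * L (inv\<^bsub>norm_aut\<^esub> a \<otimes>\<^bsub>norm_aut\<^esub> b)) \<and>
    is_dilation (metric (H, dist_on H (group_norm_dist L)))
           (metric (H, dist_on H op_dist)) (\<lambda>a. a) (real_of_ereal (1 / hol_rad H L 0))"
proof -
  interpret holonomic_space H L
    by (rule assms)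
  interpret aut: group "norm_aut :: ('v \<Rightarrow> 'v) monoid"
    by (rule group_norm_aut)
  interpret H: group_norm "norm_aut\<lparr>carrier := H\<rparr>" L
    by (rule group_norm)
  let ?\<rho> = "hol_rad H L 0"
  let ?K = "real_of_ereal (1 / ?\<rho>)"
  have H: "H \<subseteq> carrier norm_aut"
    by (rule subgroup.subset[OF subgroup])
  have id: "id \<in> H"
    using subgroup.one_closed[OF subgroup] by simp
  have quot: "inv\<^bsub>norm_aut\<^esub> a \<circ> b \<in> H" if "a \<in> H" "b \<in> H" for a b
    using that subgroup.m_inv_closed[OF subgroup] subgroup.m_closed[OF subgroup] by fastforce
  have L: "0 \<le> L A" if "A \<in> H" for A
    using H.nonneg that by simp
  have hol_iff: "hol_condition H L 0 r \<longleftrightarrow> (\<forall>A\<in>H. r * op_dist A id \<le> L A)" if "0 < r" for r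
    using H L that by (rule hol_condition_zero_iff)
  obtain r where "0 < r" "hol_condition H L 0 r"
    using local_condition by blast
  then have "ereal r \<le> ?\<rho>"
    unfolding hol_rad_def by (intro Sup_upper) auto
  then have pos: "0 < ?\<rho>"
    using \<open>0 < r\<close> by (metis ereal_less(2) less_le_trans)
  have "0 \<le> 1 / ?\<rho>"
    using pos by (cases ?\<rho>) (auto simp: one_ereal_def)
  then have K: "0 \<le> ?K"
    by (rule real_of_ereal_pos)
  have inv1: "left_invariant_metric (norm_aut\<lparr>carrier := H\<rparr>) (group_norm_dist L)"
    by (rule H.left_invariant_metric_norm)
      (simp add: group_norm_dist_def aut.m_inv_consistent[OF subgroup])
  have inv2: "left_invariant_metric (norm_aut\<lparr>carrier := H\<rparr>) op_dist"
    using H by (rule left_invariant_metric_op_dist)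
  interpret M1: Metric_space H "dist_on H (group_norm_dist L)"
    using inv1 by (simp add: left_invariant_metric_def)
  interpret M2: Metric_space H "dist_on H op_dist"
    using inv2 by (simp add: left_invariant_metric_def)
  have bound: "op_dist a b \<le> ?K * L (inv\<^bsub>norm_aut\<^esub> a \<otimes>\<^bsub>norm_aut\<^esub> b)" if "a \<in> H" "b \<in> H" for a b
  proof -
    have a: "a \<in> carrier norm_aut" and b: "b \<in> carrier norm_aut"
      using that H by auto
    show ?thesis
    proof (rule hol_rad_bound)
      show "0 \<le> op_dist a b"
        using a b by (rule op_dist_nonneg)
      show "r * op_dist a b \<le> L (inv\<^bsub>norm_aut\<^esub> a \<otimes>\<^bsub>norm_aut\<^esub> b)"
        if "0 < r" "hol_condition H L 0 r" for r
        using that hol_iff[of r] quot[OF \<open>a \<in> H\<close> \<open>b \<in> H\<close>] by (simp add: op_dist_inv_mult[OF a])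
    qed (use pos in auto)
  qed
  have lip: "lipschitz_constant (metric (H, dist_on H (group_norm_dist L)))
      (metric (H, dist_on H op_dist)) (\<lambda>a. a) C \<longleftrightarrow>
    0 \<le> C \<and> (\<forall>a\<in>H. \<forall>b\<in>H. op_dist a b \<le> C * L (inv\<^bsub>norm_aut\<^esub> a \<otimes>\<^bsub>norm_aut\<^esub> b))" for C
    by (simp add: lipschitz_constant_def M1.mspace_metric M1.mdist_metric M2.mdist_metric
        dist_on_def group_norm_dist_def)
  have lipK: "lipschitz_constant (metric (H, dist_on H (group_norm_dist L)))
      (metric (H, dist_on H op_dist)) (\<lambda>a. a) ?K"
    using K bound by (simp add: lip del: mult_norm_aut)
  have least: "?K \<le> C" if C: "lipschitz_constant (metric (H, dist_on H (group_norm_dist L)))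
      (metric (H, dist_on H op_dist)) (\<lambda>a. a) C" for C
  \<comment> \<open>The constant \<open>C\<close> may be 0, so \<open>1 / C\<close> need not be a
    radius. Each \<open>D > C\<close> is positive, and \<open>?K \<le> D\<close> for all of them
    suffices.\<close>
  proof (rule dense_ge)
    fix D
    assume "C < D"
    have "0 \<le> C"
      using C by (simp add: lip)
    then have "0 < D"
      using \<open>C < D\<close> by simp
    have "1 / D * op_dist A id \<le> L A" if A: "A \<in> H" for A
    proof -
      \<comment> \<open>Pairs starting at the identity already determine the smallest
        constant.\<close>
      have "op_dist id A \<le> C * L (inv\<^bsub>norm_aut\<^esub> id \<otimes>\<^bsub>norm_aut\<^esub> A)"
        using C id A by (simp add: lip)
      moreover have "inv\<^bsub>norm_aut\<^esub> id = (id :: 'v \<Rightarrow> 'v)"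
        using aut.inv_one by simp
      moreover have "op_dist id A = op_dist A id"
        by (simp add: op_dist_def onorm_def norm_minus_commute)
      ultimately have "op_dist A id \<le> C * L A"
        by simp
      also have "\<dots> \<le> D * L A"
        using \<open>C < D\<close> L[OF A] by (intro mult_right_mono) auto
      finally show ?thesis
        using \<open>0 < D\<close> by (simp add: field_simps)
    qed
    then have "hol_condition H L 0 (1 / D)"
      using \<open>0 < D\<close> by (simp add: hol_iff)
    then show "?K \<le> D"
      using \<open>0 < D\<close> by (intro inverse_hol_rad_le)
  qed
  have "Lipschitz_continuous_map (metric (H, dist_on H (group_norm_dist L)))
      (metric (H, dist_on H op_dist)) (\<lambda>a. a)"
    using lipK unfolding Lipschitz_continuous_map_def lipschitz_constant_def
    by (auto simp: M1.mspace_metric M2.mspace_metric)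
  then show ?thesis
    using pos inv1 inv2 bound lipK least
    by (simp add: is_dilation_def flip: op_dist_def)
qed

end
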